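(* Let the set $\mathcal T$ of (finite or infinite) ternary trees be equipped with the distance of local convergence $\tilde d$, and let the set $E$ of compact subspaces of $\tilde T$ be equipped with the Hausdorff distance. Let $t^0\in\mathcal T$ be a tree with exactly one infinite branch, given by the infinite sequence of letters $(u_0,u_1,\dots)\in\{1,2,3\}^{\mathbb N}$ (so that the nodes on the branch are $\emptyset$ and the words $(u_0,\dots,u_k)$, $k\ge0$), and assume that $|\{i: u_i=j\}|=\infty$ for every $j\in\{1,2,3\}$. Then the map $\Psi^0:\mathcal T\to E$ is continuous at $t^0$.
   Context: $A=(0,0)$, $B=(1,0)$, $C=e^{i\pi/3}$ in $\mathbb R^2\cong\mathbb C$; $T=[AB]\cup[BC]\cup[CA]$ and $\tilde T$ is the filled (closed) triangle. A ternary tree is a (possibly infinite) set $t$ of finite words on $\{1,2,3\}$ containing the empty word $\emptyset$, closed under removing the last letter, where each $u\in t$ has either none (leaf) or all three (internal node) of the children $u(1),u(2),u(3)$ in $t$. $|u|$ denotes the length of a word $u$. For $r>0$, $B_r(t)=\{u\in t:|u|\le r\}$, and $\tilde d(t,t')=\inf\{\frac1{r+1}: r>0,\ B_r(t)=B_r(t')\}$. For each word $u$ on $\{1,2,3\}$ define an ordered triple of points: $(A_\emptyset,B_\emptyset,C_\emptyset)=(A,B,C)$; $M_u=\frac13(A_u+B_u+C_u)$; the triples of $u(1),u(2),u(3)$ are $(M_u,B_u,C_u)$, $(A_u,M_u,C_u)$, $(A_u,B_u,M_u)$. For a ternary tree $t$, $\Psi^0(t)$ is the closure of $T\cup\bigcup_{u}([A_uM_u]\cup[B_uM_u]\cup[C_uM_u])$,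 the union being over internal nodes $u$ of $t$. *)

theory Defs
  imports "HOL-Analysis.Analysis"
begin

section \<open>Ternary trees and the distance of local convergence\<close>

datatype letter = L1 | L2 | L3

definition ternary_trees :: "letter list set set" where
  "ternary_trees = {t. [] \<in> t \<and> (\<forall>u i. u @ [i] \<in> t \<longrightarrow> u \<in> t) \<and>
     (\<forall>u\<in>t. (\<forall>i. u @ [i] \<notin> t) \<or> (\<forall>i. u @ [i] \<in> t))}"

definition internal_nodes :: "letter list set \<Rightarrow> letter list set" where
  "internal_nodes t = {u \<in> t. \<forall>i. u @ [i] \<in> t}"

definition tree_ball :: "real \<Rightarrow> letter list set \<Rightarrow> letter list set" where
  "tree_ball r t = {u \<in> t. real (length u) \<le> r}"

text \<open>
  The radius \<open>r\<close> ranges over the positive reals. For trees, the set of admissible \<open>r\<close> is then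
  never empty, because any two trees have the same ball of radius \<open>1/2\<close>. The value \<open>0\<close> outside
  the set of trees is a dummy, needed because the locale \<open>Metric_space\<close> asks for a nonnegative
  function on the whole type.
\<close>

definition local_dist :: "letter list set \<Rightarrow> letter list set \<Rightarrow> real" where
  "local_dist t t' = (if t \<in> ternary_trees \<and> t' \<in> ternary_trees
     then Inf {1 / (r + 1) | r. r > 0 \<and> tree_ball r t = tree_ball r t'} else 0)"

definition infinite_branch :: "letter list set \<Rightarrow> (nat \<Rightarrow> letter) \<Rightarrow> bool" where
  "infinite_branch t w \<longleftrightarrow> (\<forall>n. map w [0..<n] \<in> t)"


section \<open>Compact subsets of the filled triangle and the Hausdorff distance\<close>

definition pt_A :: complex where "pt_A = 0"
definition pt_B :: complex where "pt_B = 1"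
definition pt_C :: complex where "pt_C = exp (\<i> * of_real (pi / 3))"

definition triangle_boundary :: "complex set" where
  "triangle_boundary =
     closed_segment pt_A pt_B \<union> closed_segment pt_B pt_C \<union> closed_segment pt_C pt_A"

definition filled_triangle :: "complex set" where
  "filled_triangle = convex hull {pt_A, pt_B, pt_C}"

definition compacts :: "complex set set" where
  "compacts = {K. compact K \<and> K \<noteq> {} \<and> K \<subseteq> filled_triangle}"

text \<open>Again the value \<open>0\<close> is a dummy, taken where the suprema and infima need not make sense.\<close>

definition hausdorff_dist :: "'a::metric_space set \<Rightarrow> 'a set \<Rightarrow> real" where
  "hausdorff_dist K L = (if K \<noteq> {} \<and> L \<noteq> {} \<and> bounded K \<and> bounded L
     then max (SUP x\<in>K. infdist x L) (SUP y\<in>L. infdist y K) else 0)"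


section \<open>The map \<open>\<Psi>\<^sup>0\<close>\<close>

fun centroid :: "complex \<times> complex \<times> complex \<Rightarrow> complex" where
  "centroid (a, b, c) = (a + b + c) / 3"

fun child_triple ::
    "complex \<times> complex \<times> complex \<Rightarrow> letter \<Rightarrow> complex \<times> complex \<times> complex" where
  "child_triple (a, b, c) L1 = (centroid (a, b, c), b, c)"
| "child_triple (a, b, c) L2 = (a, centroid (a, b, c), c)"
| "child_triple (a, b, c) L3 = (a, b, centroid (a, b, c))"

text \<open>The children of \<open>u\<close> are the words \<open>u @ [i]\<close>, so words are read from left to right.\<close>

definition triple :: "letter list \<Rightarrow> complex \<times> complex \<times> complex" where
  "triple u = foldl child_triple (pt_A, pt_B, pt_C) u"

definition spokes :: "letter list \<Rightarrow> complex set" where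
  "spokes u = (case triple u of (a, b, c) \<Rightarrow>
     closed_segment a (centroid (a, b, c)) \<union>
     closed_segment b (centroid (a, b, c)) \<union>
     closed_segment c (centroid (a, b, c)))"

definition Psi0 :: "letter list set \<Rightarrow> complex set" where
  "Psi0 t = closure (triangle_boundary \<union> (\<Union>u\<in>internal_nodes t. spokes u))"


section \<open>Both distances are metrics\<close>

lemma tree_ball_mono:
  assumes "tree_ball r t = tree_ball r t'" "s \<le> r"
  shows "tree_ball s t = tree_ball s t'"
proof -
  have "tree_ball s x = {u \<in> tree_ball r x. real (length u) \<le> s}" for x
    using assms(2) by (auto simp: tree_ball_def)
  then show ?thesis using assms(1) by simp
qed

lemma local_dist_less_iff:
  assumes "t \<in> ternary_trees" "t' \<in> ternary_trees"
  shows "local_dist t t' < e \<longleftrightarrow> (\<exists>r>0. tree_ball r t = tree_ball r t' \<and> 1 / (r + 1) < e)"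
proof -
  let ?S = "{1 / (r + 1) | r. r > 0 \<and> tree_ball r t = tree_ball r t'}"
  have "tree_ball (1/2) x = {[]}" if "x \<in> ternary_trees" for x
  proof -
    have "u = []" if "real (length u) \<le> 1 / 2" for u :: "letter list"
      using that by (cases u) auto
    then show ?thesis using that by (auto simp: tree_ball_def ternary_trees_def)
  qed
  then have "tree_ball (1/2) t = tree_ball (1/2) t'"
    using assms by metis
  then have "1 / (1/2 + 1) \<in> ?S"
    by (intro CollectI exI[of _ "1/2"]) auto
  then have ne: "?S \<noteq> {}" by blast
  have "bdd_below ?S"
    by (rule bdd_belowI[of _ 0]) auto
  then have "Inf ?S < e \<longleftrightarrow> (\<exists>x\<in>?S. x < e)"
    by (rule cInf_less_iff[OF ne])
  then show ?thesis using assms by (auto simp: local_dist_def)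
qed

lemma local_dist_nonneg: "0 \<le> local_dist t t'"
proof (cases "t \<in> ternary_trees \<and> t' \<in> ternary_trees")
  case True
  then show ?thesis
    using local_dist_less_iff[of t t' 0] by (force simp: not_less[symmetric])
qed (auto simp: local_dist_def)

lemma local_dist_commute: "local_dist t t' = local_dist t' t"
proof -
  have "(tree_ball r t = tree_ball r t') = (tree_ball r t' = tree_ball r t)" for r by auto
  then show ?thesis by (auto simp: local_dist_def)
qed

lemma Metric_space_local_dist: "Metric_space ternary_trees local_dist"
proof
  fix x y z assume x: "x \<in> ternary_trees" and y: "y \<in> ternary_trees"
  show "local_dist x y = 0 \<longleftrightarrow> x = y"
  proof
    assume d: "local_dist x y = 0"
    have "w \<in> x \<longleftrightarrow> w \<in> y" for w
    proof -
      have "local_dist x y < 1 / (real (length w) + 1)" using d by simp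
      then obtain r where r: "r > 0" "tree_ball r x = tree_ball r y"
          "1 / (r + 1) < 1 / (real (length w) + 1)"
        using local_dist_less_iff[OF x y] by blast
      then have "real (length w) \<le> r" by (simp add: field_simps)
      then show ?thesis using r(2) by (auto simp: tree_ball_def set_eq_iff)
    qed
    then show "x = y" by blast
  next
    assume e: "x = y"
    have "\<not> 0 < local_dist x y"
    proof
      assume p: "0 < local_dist x y"
      obtain n :: nat where "1 / local_dist x y < real n" using reals_Archimedean2 by blast
      moreover from this have "0 < real n" using p
        by (smt (verit) divide_pos_pos)
      ultimately have "0 < real n" "1 / (real n + 1) < local_dist x y"
        using p by (auto simp: field_simps)
      then have "local_dist x y < local_dist x y"
        using local_dist_less_iff[OF x y] e by blast
      then show False by simp
    qed
    then show "local_dist x y = 0" using local_dist_nonneg[of x y] by linarith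
  qed
  assume z: "z \<in> ternary_trees"
  have "local_dist x z < e" if e: "local_dist x y < e" "local_dist y z < e" for e
  proof -
    obtain r s where r: "r > 0" "tree_ball r x = tree_ball r y" "1 / (r + 1) < e"
      and s: "s > 0" "tree_ball s y = tree_ball s z" "1 / (s + 1) < e"
      using e local_dist_less_iff x y z by meson
    have "tree_ball (min r s) x = tree_ball (min r s) z"
      using tree_ball_mono[OF r(2)] tree_ball_mono[OF s(2)] by simp
    moreover have "min r s > 0" "1 / (min r s + 1) < e" using r s by (auto simp: min_def)
    ultimately show ?thesis using local_dist_less_iff[OF x z] by blast
  qed
  from this[of "local_dist x z"]
  have "local_dist x z \<le> max (local_dist x y) (local_dist y z)" by fastforce
  then show "local_dist x z \<le> local_dist x y + local_dist y z"
    using local_dist_nonneg[of x y] local_dist_nonneg[of y z] by linarith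
qed (auto simp: local_dist_nonneg local_dist_commute)

lemma bdd_above_infdist:
  fixes K L :: "'a::metric_space set"
  assumes "bounded K" "L \<noteq> {}"
  shows "bdd_above ((\<lambda>x. infdist x L) ` K)"
proof -
  obtain l where l: "l \<in> L" using assms by blast
  obtain e where "\<forall>x\<in>K. dist l x \<le> e" using assms bounded_any_center by blast
  then have "\<forall>x\<in>K. infdist x L \<le> e" using l by (metis dist_commute infdist_le2)
  then show ?thesis by (auto intro: bdd_aboveI)
qed

lemma hausdorff_dist_le_iff:
  fixes K L :: "'a::metric_space set"
  assumes "bounded K" "bounded L" "K \<noteq> {}" "L \<noteq> {}"
  shows "hausdorff_dist K L \<le> e \<longleftrightarrow> (\<forall>x\<in>K. infdist x L \<le> e) \<and> (\<forall>y\<in>L. infdist y K \<le> e)"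
  using assms by (simp add: hausdorff_dist_def cSUP_le_iff bdd_above_infdist)

lemma hausdorff_dist_nonneg: "0 \<le> hausdorff_dist K L"
proof (cases "K \<noteq> {} \<and> L \<noteq> {} \<and> bounded K \<and> bounded L")
  case True
  then obtain x where "x \<in> K" by blast
  then have "infdist x L \<le> hausdorff_dist K L"
    using hausdorff_dist_le_iff[of K L "hausdorff_dist K L"] True by blast
  then show ?thesis using infdist_nonneg[of x L] by linarith
qed (auto simp: hausdorff_dist_def)

lemma hausdorff_dist_commute: "hausdorff_dist K L = hausdorff_dist L K"
  by (auto simp: hausdorff_dist_def max.commute)

lemma infdist_triangle_le:
  fixes L N :: "'a::heine_borel set"
  assumes "compact L" "L \<noteq> {}" "infdist x L \<le> a" "\<And>y. y \<in> L \<Longrightarrow> infdist y N \<le> b"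
  shows "infdist x N \<le> a + b"
proof -
  obtain y where y: "y \<in> L" "infdist x L = dist x y"
    using infdist_attains_inf[of L x] assms compact_imp_closed by blast
  then show ?thesis using infdist_triangle[of x N y] assms(3) assms(4)[of y] by linarith
qed

lemma Metric_space_hausdorff_dist: "Metric_space compacts hausdorff_dist"
proof
  fix K L N assume K: "K \<in> compacts" and L: "L \<in> compacts"
  have KL: "compact K" "compact L" "bounded K" "bounded L" "K \<noteq> {}" "L \<noteq> {}"
      "closed K" "closed L"
    using K L by (auto simp: compacts_def compact_imp_bounded compact_imp_closed)
  show "hausdorff_dist K L = 0 \<longleftrightarrow> K = L"
  proof -
    have "hausdorff_dist K L = 0 \<longleftrightarrow> hausdorff_dist K L \<le> 0"
      using hausdorff_dist_nonneg[of K L] by linarith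
    also have "\<dots> \<longleftrightarrow> (\<forall>x\<in>K. infdist x L = 0) \<and> (\<forall>y\<in>L. infdist y K = 0)"
      using KL by (simp add: hausdorff_dist_le_iff infdist_nonneg order_antisym_conv)
    also have "\<dots> \<longleftrightarrow> K = L"
      using KL in_closed_iff_infdist_zero[of K] in_closed_iff_infdist_zero[of L] by blast
    finally show ?thesis .
  qed
  assume N: "N \<in> compacts"
  have N': "compact N" "bounded N" "N \<noteq> {}"
    using N by (auto simp: compacts_def compact_imp_bounded)
  have 1: "infdist x L \<le> hausdorff_dist K L" if "x \<in> K" for x
    using hausdorff_dist_le_iff[of K L "hausdorff_dist K L"] KL that by blast
  have 2: "infdist x K \<le> hausdorff_dist K L" if "x \<in> L" for x
    using hausdorff_dist_le_iff[of K L "hausdorff_dist K L"] KL that by blast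
  have 3: "infdist x N \<le> hausdorff_dist L N" if "x \<in> L" for x
    using hausdorff_dist_le_iff[of L N "hausdorff_dist L N"] KL N' that by blast
  have 4: "infdist x L \<le> hausdorff_dist L N" if "x \<in> N" for x
    using hausdorff_dist_le_iff[of L N "hausdorff_dist L N"] KL N' that by blast
  have "infdist x N \<le> hausdorff_dist K L + hausdorff_dist L N" if "x \<in> K" for x
    using infdist_triangle_le[OF KL(2,6) 1[OF that] 3] .
  moreover have "infdist x K \<le> hausdorff_dist L N + hausdorff_dist K L" if "x \<in> N" for x
    using infdist_triangle_le[OF KL(2,6) 4[OF that] 2] .
  ultimately show "hausdorff_dist K N \<le> hausdorff_dist K L + hausdorff_dist L N"
    using KL N' by (auto simp: hausdorff_dist_le_iff add.commute)
qed (auto simp: hausdorff_dist_nonneg hausdorff_dist_commute)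

text \<open>
  A further check of the encoding: the map \<open>Psi0\<close> has values in \<open>compacts\<close>.
\<close>

lemma triple_in_filled_triangle:
  "case triple u of (a, b, c) \<Rightarrow> {a, b, c} \<subseteq> filled_triangle"
proof (induction u rule: rev_induct)
  case Nil
  then show ?case by (auto simp: triple_def filled_triangle_def hull_inc)
next
  case (snoc i u)
  obtain a b c where t: "triple u = (a, b, c)" by (cases "triple u")
  have "centroid (a, b, c) \<in> convex hull {a, b, c}"
    unfolding convex_hull_3
    by (auto intro!: exI[of _ "1/3"] simp: scaleR_conv_of_real add_divide_distrib)
  moreover have "convex hull {a, b, c} \<subseteq> filled_triangle"
    using snoc t unfolding filled_triangle_def by (intro hull_minimal) auto
  ultimately show ?case
    using snoc t by (cases i) (auto simp: triple_def)
qed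

lemma spokes_subset: "spokes u \<subseteq> filled_triangle"
proof -
  obtain a b c where t: "triple u = (a, b, c)" by (cases "triple u")
  have "{a, b, c} \<subseteq> filled_triangle" "centroid (a, b, c) \<in> filled_triangle"
    using triple_in_filled_triangle[of u] triple_in_filled_triangle[of "u @ [L1]"] t
    by (auto simp: triple_def)
  moreover have "convex filled_triangle" by (simp add: filled_triangle_def)
  ultimately show ?thesis
    by (simp add: spokes_def t closed_segment_subset)
qed

lemma Psi0_in_compacts: "Psi0 t \<in> compacts"
proof -
  have c: "compact filled_triangle" "convex filled_triangle"
    by (auto simp: filled_triangle_def finite_imp_compact_convex_hull)
  have "{pt_A, pt_B, pt_C} \<subseteq> filled_triangle" by (simp add: filled_triangle_def hull_subset)
  then have "triangle_boundary \<subseteq> filled_triangle"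
    using c closed_segment_subset by (auto simp: triangle_boundary_def)
  then have sub: "Psi0 t \<subseteq> filled_triangle"
    unfolding Psi0_def using spokes_subset c(1)
    by (intro closure_minimal) (auto simp: compact_imp_closed)
  moreover have "compact (Psi0 t)"
    using sub c(1) by (metis Psi0_def closed_closure compact_Int_closed inf.absorb2)
  moreover have "Psi0 t \<noteq> {}"
    by (auto simp: Psi0_def triangle_boundary_def)
  ultimately show ?thesis by (simp add: compacts_def)
qed

end

theory Submission
  imports Defs "HOL-Library.Sublist"
begin

text \<open>
  Koenig's lemma shows that for every \<open>n\<close> only finitely many nodes of \<open>t\<^sub>0\<close> fail to descend from
  the node \<open>w\<^sub>0 \<dots> w\<^sub>n\<^sub>-\<^sub>1\<close> of the infinite branch. A tree that is locally close to \<open>t\<^sub>0\<close> therefore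
  has the same internal nodes as \<open>t\<^sub>0\<close>, except for descendants of \<open>w\<^sub>0 \<dots> w\<^sub>n\<^sub>-\<^sub>1\<close>. These only
  contribute segments inside the triangle of \<open>w\<^sub>0 \<dots> w\<^sub>n\<^sub>-\<^sub>1\<close>, whose vertices belong to both images,
  so it remains to see that these triangles shrink to a point. For a real linear form, let \<open>L\<close> and
  \<open>l\<close> be the limits of the maximum and the minimum over the vertices. If \<open>l < L\<close>, then eventually
  the centroids lie strictly below \<open>L\<close>; once all three vertices have been replaced, the maximum
  lies below its own limit.
\<close>

section \<open>Repeated averaging of three real numbers\<close>

lemma spread_tendsto_0:
  fixes v :: "nat \<Rightarrow> letter \<Rightarrow> real" and w :: "nat \<Rightarrow> letter"
  assumes step: "\<And>n i. v (Suc n) i = (if i = w n then (v n L1 + v n L2 + v n L3) / 3 else v n i)"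
    and inf: "\<And>j. infinite {i. w i = j}"
    and "e > 0"
  shows "\<forall>\<^sub>F n in sequentially. \<forall>i j. v n i - v n j < e"
proof -
  define M where "M n = max (v n L1) (max (v n L2) (v n L3))" for n
  define m where "m n = min (v n L1) (min (v n L2) (v n L3))" for n
  have vM: "v n i \<le> M n" and vm: "m n \<le> v n i" for n i
    by (cases i; simp add: M_def m_def)+
  have ex_M: "\<exists>i. M n = v n i" and ex_m: "\<exists>i. m n = v n i" for n
    unfolding M_def m_def max_def min_def by metis+
  have avg: "(v n L1 + v n L2 + v n L3) / 3 \<le> (2 * M n + m n) / 3"
    "m n \<le> (v n L1 + v n L2 + v n L3) / 3" for n
    unfolding M_def m_def max_def min_def by auto
  have mM: "m n \<le> M n" for n
    using vM[of n L1] vm[of n L1] by linarith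
  have "v (Suc n) i \<le> M n" "m n \<le> v (Suc n) i" for n i
    using avg[of n] mM[of n] vM[of n i] vm[of n i] by (auto simp: step)
  then have dec: "decseq M" and inc: "incseq m"
    unfolding decseq_Suc_iff incseq_Suc_iff using ex_M ex_m by metis+
  have "m 0 \<le> M n" "m n \<le> M 0" for n
    using incseqD[OF inc, of 0 n] decseqD[OF dec, of 0 n] mM[of n] by auto
  then obtain L l where L: "M \<longlonglongrightarrow> L" and l: "m \<longlonglongrightarrow> l"
    using decseq_convergent[OF dec] incseq_convergent[OF inc] by metis
  have LM: "L \<le> M n" and lm: "m n \<le> l" for n
    using decseq_ge[OF dec L] incseq_le[OF inc l] by auto
  have "L \<le> l"
  proof (rule ccontr)
    assume "\<not> L \<le> l"
    \<comment> \<open>With \<open>m n\<close> at most \<open>l\<close>, this bound makes the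
      average, which is at most \<open>(2 * M n + m n) / 3\<close>, smaller than
      \<open>(2 * L + (L - l) + l) / 3 = L\<close>.\<close>
    then have "\<forall>\<^sub>F n in sequentially. M n < L + (L - l) / 2"
      by (intro order_tendstoD(2)[OF L]) auto
    then obtain N where N: "\<And>n. n \<ge> N \<Longrightarrow> M n < L + (L - l) / 2"
      by (auto simp: eventually_sequentially)
    have centroid_less: "(v n L1 + v n L2 + v n L3) / 3 < L" if "n \<ge> N" for n
      using avg(1)[of n] N[OF that] lm[of n] by argo
    have "\<forall>\<^sub>F n in sequentially. v n j < L" for j
    proof -
      \<comment> \<open>Step \<open>k\<close> puts an average below \<open>L\<close> at position
        \<open>j\<close>; each later step keeps that entry or replaces it by another average below
        \<open>L\<close>.\<close>
      obtain k where k: "k \<ge> N" "w k = j"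
        using inf[of j] by (auto simp: infinite_nat_iff_unbounded_le)
      have "v n j < L" if "n \<ge> Suc k" for n
        using that
      proof (induction n rule: dec_induct)
        case base
        then show ?case using centroid_less[OF k(1)] k(2) by (simp add: step)
      next
        case (step n)
        then show ?case using centroid_less[of n] k(1) by (simp add: assms(1))
      qed
      then show ?thesis by (auto simp: eventually_sequentially)
    qed
    then have "\<forall>\<^sub>F n in sequentially. v n L1 < L \<and> v n L2 < L \<and> v n L3 < L"
      by (intro eventually_conj)
    then obtain n where "M n < L"
      by (auto simp: M_def eventually_sequentially)
    then show False using LM[of n] by simp
  qed
  then have "\<forall>\<^sub>F n in sequentially. M n - m n < e"
    using order_tendstoD(2)[OF tendsto_diff[OF L l], of e] \<open>e > 0\<close> by simp
  then show ?thesis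
  proof eventually_elim
    case (elim n)
    then show ?case using vM[of n] vm[of n] by (smt (verit))
  qed
qed

section \<open>The triangles of the nodes\<close>

text \<open>Indexing the vertices by letters lets child \<open>i\<close> replace exactly vertex
  \<open>i\<close>, uniformly in \<open>i\<close>.\<close>

fun vertex :: "complex \<times> complex \<times> complex \<Rightarrow> letter \<Rightarrow> complex" where
  "vertex (a, b, c) L1 = a"
| "vertex (a, b, c) L2 = b"
| "vertex (a, b, c) L3 = c"

lemma UNIV_letter: "UNIV = {L1, L2, L3}"
  using letter.exhaust by blast

lemma centroid_vertex: "centroid p = (vertex p L1 + vertex p L2 + vertex p L3) / 3"
  by (cases p) simp

lemma vertex_child: "vertex (child_triple p i) j = (if j = i then centroid p else vertex p j)"
  by (cases p; cases i; cases j) simp_all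

lemma triple_snoc: "triple (u @ [i]) = child_triple (triple u) i"
  by (simp add: triple_def)

lemma spokes_eq:
  "spokes u = (\<Union>i. closed_segment (vertex (triple u) i) (centroid (triple u)))"
  by (cases "triple u") (auto simp: spokes_def UNIV_letter)

lemma centroid_in_hull: "centroid p \<in> convex hull (range (vertex p))"
proof -
  obtain a b c where p: "p = (a, b, c)" by (cases p)
  have "centroid (a, b, c) \<in> convex hull {a, b, c}"
    unfolding convex_hull_3
    by (auto intro!: exI[of _ "1/3"] simp: scaleR_conv_of_real add_divide_distrib)
  then show ?thesis by (simp add: p UNIV_letter)
qed

lemma hull_child: "convex hull (range (vertex (child_triple p i))) \<subseteq> convex hull (range (vertex p))"
  by (intro hull_minimal) (auto simp: vertex_child centroid_in_hull hull_inc)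

lemma hull_append:
  "convex hull (range (vertex (triple (u @ v)))) \<subseteq> convex hull (range (vertex (triple u)))"
proof (induction v rule: rev_induct)
  case (snoc i v)
  then show ?case
    using hull_child[of "triple (u @ v)" i] by (simp add: triple_snoc flip: append_assoc)
qed simp

lemma spokes_subset_hull:
  assumes "prefix u v"
  shows "spokes v \<subseteq> convex hull (range (vertex (triple u)))"
proof -
  have "spokes v \<subseteq> convex hull (range (vertex (triple v)))"
    unfolding spokes_eq
    by (intro UN_least closed_segment_subset) (auto simp: centroid_in_hull hull_inc)
  also have "\<dots> \<subseteq> convex hull (range (vertex (triple u)))"
    using assms hull_append by (auto simp: prefix_def)
  finally show ?thesis .
qed

lemma branch_triangles_shrink:
  assumes inf: "\<And>j. infinite {i. w i = j}" and "e > 0"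
  shows "\<exists>n. \<forall>i j. dist (vertex (triple (map w [0..<n])) i) (vertex (triple (map w [0..<n])) j) < e"
proof -
  define p where "p n = vertex (triple (map w [0..<n]))" for n
  have step: "p (Suc n) i = (if i = w n then (p n L1 + p n L2 + p n L3) / 3 else p n i)" for n i
    by (simp add: p_def triple_snoc vertex_child centroid_vertex)
  have "\<forall>\<^sub>F n in sequentially. \<forall>i j. Re (p n i) - Re (p n j) < e / 2"
    by (rule spread_tendsto_0[where w = w]) (use assms in \<open>auto simp: step\<close>)
  moreover have "\<forall>\<^sub>F n in sequentially. \<forall>i j. Im (p n i) - Im (p n j) < e / 2"
    by (rule spread_tendsto_0[where w = w]) (use assms in \<open>auto simp: step\<close>)
  ultimately have "\<forall>\<^sub>F n in sequentially. \<forall>i j. dist (p n i) (p n j) < e"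
  proof eventually_elim
    case (elim n)
    have "dist (p n i) (p n j) < e" for i j
    proof -
      have "dist (p n i) (p n j) \<le> \<bar>Re (p n i - p n j)\<bar> + \<bar>Im (p n i - p n j)\<bar>"
        unfolding dist_norm by (rule cmod_le)
      \<comment> \<open>The one-sided bounds for \<open>(i, j)\<close> and \<open>(j, i)\<close>
        together bound the absolute values.\<close>
      moreover have "\<bar>Re (p n i - p n j)\<bar> < e / 2" "\<bar>Im (p n i - p n j)\<bar> < e / 2"
        using elim(1)[rule_format, of i j] elim(1)[rule_format, of j i]
          elim(2)[rule_format, of i j] elim(2)[rule_format, of j i] by (auto simp: abs_if)
      ultimately show ?thesis by linarith
    qed
    then show ?case by blast
  qed
  then show ?thesis by (auto simp: p_def eventually_sequentially)
qed

section \<open>Nodes off the infinite branch\<close>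

lemma prefix_in_tree:
  assumes "t \<in> ternary_trees" "v \<in> t" "prefix u v"
  shows "u \<in> t"
  using assms(2,3)
proof (induction v rule: rev_induct)
  case (snoc i v)
  then show ?case using assms(1) by (auto simp: ternary_trees_def)
qed simp

text \<open>A word extending \<open>u\<close> is \<open>u\<close> itself or extends one of the three
  words \<open>u @ [i]\<close>, so one of these again has infinitely many extensions in
  \<open>S\<close>. The set \<open>S\<close> may be arbitrary, so that it can later consist of the
  nodes off a subtree.\<close>

lemma koenig:
  assumes "infinite S"
  obtains f :: "nat \<Rightarrow> letter" where "\<And>n. infinite {v \<in> S. prefix (map f [0..<n]) v}"
proof -
  define P where "P u = infinite {v \<in> S. prefix u v}" for u
  have ex: "\<exists>i. P (u @ [i])" if "P u" for u
  proof (rule ccontr)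
    assume "\<nexists>i. P (u @ [i])"
    then have "finite ({u} \<union> (\<Union>i\<in>{L1, L2, L3}. {v \<in> S. prefix (u @ [i]) v}))"
      by (auto simp: P_def)
    moreover have "{v \<in> S. prefix u v} \<subseteq> {u} \<union> (\<Union>i\<in>{L1, L2, L3}. {v \<in> S. prefix (u @ [i]) v})"
    proof
      fix v assume v: "v \<in> {v \<in> S. prefix u v}"
      then obtain x where "v = u @ x" by (auto simp: prefix_def)
      then show "v \<in> {u} \<union> (\<Union>i\<in>{L1, L2, L3}. {v \<in> S. prefix (u @ [i]) v})"
        using v by (cases x) (auto simp flip: UNIV_letter)
    qed
    ultimately show False using that finite_subset unfolding P_def by blast
  qed
  define g where "g = rec_nat [] (\<lambda>_ u. u @ [SOME i. P (u @ [i])])"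
  define f where "f k = (SOME i. P (g k @ [i]))" for k
  have g: "map f [0..<k] = g k" for k
    by (induction k) (auto simp: g_def f_def)
  have "P (g k)" for k
  proof (induction k)
    case 0
    then show ?case using assms by (simp add: g_def P_def)
  next
    case (Suc k)
    then show ?case using someI_ex[OF ex] by (simp add: g_def)
  qed
  then show ?thesis using that[of f] by (simp add: P_def g)
qed

text \<open>Otherwise Koenig's lemma yields a path \<open>f\<close> all of whose initial segments
  are prefixes of nodes in the set. These segments lie in \<open>t\<close>, so \<open>f = w\<close>;
  but then some node of the set has the excluded prefix.\<close>

lemma finite_off_branch:
  assumes t: "t \<in> ternary_trees" and uniq: "\<And>w'. infinite_branch t w' \<Longrightarrow> w' = w"
  shows "finite {u \<in> t. \<not> prefix (map w [0..<n]) u}" (is "finite ?S")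
proof (rule ccontr)
  assume "infinite ?S"
  then obtain f where f: "\<And>k. infinite {v \<in> ?S. prefix (map f [0..<k]) v}"
    using koenig by blast
  have ex: "\<exists>v\<in>?S. prefix (map f [0..<k]) v" for k
    using f[of k] not_finite_existsD by blast
  then have "infinite_branch t f"
    using prefix_in_tree[OF t] by (auto simp: infinite_branch_def)
  then show False using uniq ex[of n] by blast
qed

lemma tree_ball_eqD:
  assumes "tree_ball r s = tree_ball r t" "real (length u) \<le> r"
  shows "u \<in> s \<longleftrightarrow> u \<in> t"
proof -
  have "u \<in> tree_ball r s \<longleftrightarrow> u \<in> tree_ball r t" by (simp only: assms(1))
  then show ?thesis using assms(2) by (simp add: tree_ball_def)
qed

text \<open>Only \<open>s\<close> is known to have no nodes of length above \<open>N\<close> off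
  \<open>b\<close>. A longer node of \<open>t\<close> off \<open>b\<close> would, cut to length
  \<open>Suc N\<close>, give such a node of \<open>s\<close>. Radius \<open>Suc N\<close> also
  covers the children of nodes of length \<open>N\<close>.\<close>

lemma internal_nodes_off_subtree_subset:
  assumes t: "t \<in> ternary_trees"
    and ball: "tree_ball (real (Suc N)) s = tree_ball (real (Suc N)) t"
    and off: "\<And>u. u \<in> s \<Longrightarrow> \<not> prefix b u \<Longrightarrow> length u \<le> N"
    and u: "u \<in> internal_nodes t" "\<not> prefix b u"
  shows "u \<in> internal_nodes s"
proof -
  have agree: "v \<in> s \<longleftrightarrow> v \<in> t" if "length v \<le> Suc N" for v
    using tree_ball_eqD[OF ball] that by simp
  have "length u \<le> N"
  proof (rule ccontr)
    assume "\<not> length u \<le> N"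
    then have "length (take (Suc N) u) = Suc N" by simp
    moreover have "take (Suc N) u \<in> t"
      using prefix_in_tree[OF t] u take_is_prefix by (auto simp: internal_nodes_def)
    moreover have "\<not> prefix b (take (Suc N) u)"
      using u(2) take_is_prefix prefix_order.trans by blast
    ultimately show False using agree[of "take (Suc N) u"] off[of "take (Suc N) u"] by simp
  qed
  then show ?thesis using u(1) agree by (auto simp: internal_nodes_def)
qed

section \<open>Comparison of the images\<close>

lemma triangle_boundary_subset_Psi0: "triangle_boundary \<subseteq> Psi0 t"
  and spokes_subset_Psi0: "u \<in> internal_nodes t \<Longrightarrow> spokes u \<subseteq> Psi0 t"
  unfolding Psi0_def by (rule order_trans[OF _ closure_subset], blast)+

text \<open>Each vertex is a corner of the initial triangle or the centroid of a proper prefix of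
  \<open>u\<close>, which is an internal node because it has a child in \<open>t\<close>.\<close>

lemma vertex_in_Psi0:
  assumes t: "t \<in> ternary_trees" and "u \<in> t"
  shows "vertex (triple u) i \<in> Psi0 t"
  using assms(2)
proof (induction u arbitrary: i rule: rev_induct)
  case Nil
  have "vertex (triple []) i \<in> triangle_boundary"
    by (cases i) (auto simp: triple_def triangle_boundary_def)
  then show ?case using triangle_boundary_subset_Psi0 by blast
next
  case (snoc k u)
  then have u: "u \<in> internal_nodes t"
    using t by (auto simp: ternary_trees_def internal_nodes_def)
  have "centroid (triple u) \<in> spokes u" by (auto simp: spokes_eq)
  then have "centroid (triple u) \<in> Psi0 t"
    using spokes_subset_Psi0[OF u] by blast
  moreover have "vertex (triple u) i \<in> Psi0 t"
    using snoc.IH u by (simp add: internal_nodes_def)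
  ultimately show ?case by (simp add: triple_snoc vertex_child)
qed

text \<open>Spokes below \<open>b\<close> stay in the triangle of \<open>b\<close>, within
  \<open>e\<close> of a vertex that lies in \<open>Psi0 s\<close>; everything else already belongs
  to \<open>Psi0 s\<close>. Being one-sided, the estimate serves for both halves of the Hausdorff
  distance.\<close>

lemma infdist_Psi0_le:
  assumes s: "s \<in> ternary_trees" "b \<in> s"
    and small: "\<And>i j. dist (vertex (triple b) i) (vertex (triple b) j) \<le> e"
    and sub: "\<And>u. u \<in> internal_nodes t \<Longrightarrow> \<not> prefix b u \<Longrightarrow> u \<in> internal_nodes s"
    and x: "x \<in> Psi0 t"
  shows "infdist x (Psi0 s) \<le> e"
proof -
  have "0 \<le> e" using small[of L1 L1] by simp
  have "infdist y (Psi0 s) \<le> e"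
    if y: "y \<in> triangle_boundary \<union> (\<Union>u\<in>internal_nodes t. spokes u)" for y
  proof (cases "\<exists>u. prefix b u \<and> y \<in> spokes u")
    case True
    then have "y \<in> convex hull (range (vertex (triple b)))"
      using spokes_subset_hull by blast
    also have "\<dots> \<subseteq> cball (vertex (triple b) L1) e"
      by (intro hull_minimal) (auto simp: small)
    finally show ?thesis
      using infdist_le2[OF vertex_in_Psi0[OF s, of L1], of y e] by (simp add: dist_commute)
  next
    case False
    then have "y \<in> triangle_boundary \<union> (\<Union>u\<in>internal_nodes s. spokes u)"
      using y sub by blast
    then have "y \<in> Psi0 s"
      using triangle_boundary_subset_Psi0 spokes_subset_Psi0 by blast
    then show ?thesis using \<open>0 \<le> e\<close> by simp
  qed
  \<comment> \<open>Closedness carries the bound over to the closure in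
    \<open>Psi0 t\<close>.\<close>
  moreover have "closed {y. infdist y (Psi0 s) \<le> e}"
    by (intro closed_Collect_le continuous_intros)
  ultimately have "Psi0 t \<subseteq> {y. infdist y (Psi0 s) \<le> e}"
    unfolding Psi0_def[of t] by (intro closure_minimal) auto
  then show ?thesis using x by blast
qed

lemma Psi0_close:
  assumes t0: "t0 \<in> ternary_trees" and branch: "infinite_branch t0 w"
    and uniq: "\<And>w'. infinite_branch t0 w' \<Longrightarrow> w' = w"
    and inf: "\<And>j. infinite {i. w i = j}" and "e > 0"
  obtains d where "d > 0"
    "\<And>t. t \<in> ternary_trees \<Longrightarrow> local_dist t0 t < d \<Longrightarrow> hausdorff_dist (Psi0 t0) (Psi0 t) \<le> e"
proof -
  obtain n where small: "\<And>i j. dist (vertex (triple (map w [0..<n])) i)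
      (vertex (triple (map w [0..<n])) j) < e"
    using branch_triangles_shrink[OF inf \<open>e > 0\<close>] by blast
  define b where "b = map w [0..<n]"
  have fin: "finite {u \<in> t0. \<not> prefix b u}"
    unfolding b_def using t0 uniq by (rule finite_off_branch)
  \<comment> \<open>Inserting \<open>n\<close> ensures that \<open>b\<close>, of length
    \<open>n\<close>, lies in the ball that is compared.\<close>
  define N where "N = Max (insert n (length ` {u \<in> t0. \<not> prefix b u}))"
  have N: "length u \<le> N" if "u \<in> t0" "\<not> prefix b u" for u
    unfolding N_def using fin that by (auto intro!: Max_ge)
  have nN: "n \<le> N" unfolding N_def using fin by auto
  show ?thesis
  proof (rule that[of "1 / (real (Suc N) + 1)"])
    fix t assume t: "t \<in> ternary_trees" and "local_dist t0 t < 1 / (real (Suc N) + 1)"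
    \<comment> \<open>The bound on \<open>1 / (r + 1)\<close> forces
      \<open>r > Suc N\<close>.\<close>
    then obtain r where r: "r > 0" "tree_ball r t0 = tree_ball r t"
        "1 / (r + 1) < 1 / (real (Suc N) + 1)"
      using local_dist_less_iff[OF t0 t] by blast
    then have ball: "tree_ball (real (Suc N)) t0 = tree_ball (real (Suc N)) t"
      by (intro tree_ball_mono[OF r(2)]) (simp add: field_simps)
    have agree: "v \<in> t0 \<longleftrightarrow> v \<in> t" if "length v \<le> Suc N" for v
      using tree_ball_eqD[OF ball] that by simp
    have b0: "b \<in> t0" using branch by (simp add: infinite_branch_def b_def)
    then have bt: "b \<in> t" using agree[of b] nN by (simp add: b_def)
    have sub: "u \<in> internal_nodes t0" if "u \<in> internal_nodes t" "\<not> prefix b u" for u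
      using internal_nodes_off_subtree_subset[OF t ball N] that by blast
    have sub': "u \<in> internal_nodes t" if "u \<in> internal_nodes t0" "\<not> prefix b u" for u
      using that N[of u] agree by (auto simp: internal_nodes_def)
    have small': "dist (vertex (triple b) i) (vertex (triple b) j) \<le> e" for i j
      using small[of i j] by (simp add: b_def)
    show "hausdorff_dist (Psi0 t0) (Psi0 t) \<le> e"
      using Psi0_in_compacts[of t0] Psi0_in_compacts[of t]
        infdist_Psi0_le[OF t0 b0 small' sub] infdist_Psi0_le[OF t bt small' sub']
      by (subst hausdorff_dist_le_iff) (auto simp: compacts_def compact_imp_bounded)
  qed simp
qed

theorem theorem3p15:
  fixes t0 :: "letter list set" and w :: "nat \<Rightarrow> letter"
  assumes "t0 \<in> ternary_trees"
    and "infinite_branch t0 w"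
    and "\<And>w'. infinite_branch t0 w' \<Longrightarrow> w' = w"
    and "\<And>j. infinite {i. w i = j}"
  shows "topcontinuous_at (Metric_space.mtopology ternary_trees local_dist)
           (Metric_space.mtopology compacts hausdorff_dist) Psi0 t0"
proof -
  interpret X: Metric_space ternary_trees local_dist by (rule Metric_space_local_dist)
  interpret Y: Metric_space compacts hausdorff_dist by (rule Metric_space_hausdorff_dist)
  have "\<exists>U. openin X.mtopology U \<and> t0 \<in> U \<and> (\<forall>t\<in>U. Psi0 t \<in> V)"
    if V: "openin Y.mtopology V" "Psi0 t0 \<in> V" for V
  proof -
    obtain e where e: "e > 0" "Y.mball (Psi0 t0) e \<subseteq> V"
      using V Y.openin_mtopology by blast
    \<comment> \<open>Halving \<open>e\<close> turns the non-strict estimate into membership in the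
      open ball.\<close>
    obtain d where d: "d > 0" "\<And>t. t \<in> ternary_trees \<Longrightarrow> local_dist t0 t < d \<Longrightarrow>
        hausdorff_dist (Psi0 t0) (Psi0 t) \<le> e / 2"
      using Psi0_close[OF assms, of "e / 2"] e(1) by auto
    have "Psi0 t \<in> V" if "t \<in> X.mball t0 d" for t
    proof -
      have "hausdorff_dist (Psi0 t0) (Psi0 t) < e"
        using d(2)[of t] that e(1) by (simp add: X.in_mball)
      then show ?thesis using e(2) Psi0_in_compacts by (auto simp: subset_iff Y.in_mball)
    qed
    then show ?thesis
      using X.openin_mball[of t0 d] X.centre_in_mball_iff[of t0 d] assms(1) d(1) by blast
  qed
  then show ?thesis
    using assms(1) Psi0_in_compacts by (auto simp: topcontinuous_at_def)
qed

end
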